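(* Let $F=\{f_i\}_{i=1}^n$ be a basis for $\mathcal{H}^n$. Then $F$ is scalable if and only if $F$ is an orthogonal basis.
   Context: $\mathcal{H}^n$ denotes $\mathbb{R}^n$ or $\mathbb{C}^n$. A finite sequence $\{f_i\}_{i=1}^k$ in $\mathcal{H}^n$ is a Parseval frame for $\mathcal{H}^n$ if $\sum_{i=1}^k|\langle f,f_i\rangle|^2=\|f\|^2$ for all $f\in\mathcal{H}^n$. A frame (finite spanning sequence) $F=\{f_i\}_{i=1}^k$ for $\mathcal{H}^n$ is scalable if there exist scalars $\{c_i\}_{i=1}^k$ such that $\{c_if_i\}_{i=1}^k$ is a Parseval frame for $\mathcal{H}^n$. *)

theory Defs
  imports "Jordan_Normal_Form.Gram_Schmidt" "HOL-Analysis.L2_Norm"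
begin

text \<open>
  The definitions are polymorphic in the scalars and are meant to be used at the types
  real and complex, where \<open>v \<bullet>c w\<close> is the standard inner product
  (linear in \<open>v\<close>, conjugate-linear in \<open>w\<close>).
  Vectors of the space of dimension \<open>n\<close> are the elements of \<open>carrier_vec n\<close>, and a finite
  sequence of vectors is a list, so that repetitions are possible.
\<close>

definition euclidean_norm :: "'a :: real_normed_field vec \<Rightarrow> real" where
  "euclidean_norm v = L2_set (\<lambda>i. norm (v $ i)) {..<dim_vec v}"

text \<open>\<open>vectorspace.basis\<close> is about sets; a sequence with a repeated vector is not a basis.\<close>

definition basis_seq :: "nat \<Rightarrow> 'a :: field vec list \<Rightarrow> bool" where
  "basis_seq n F \<longleftrightarrow>
     distinct F \<and> vectorspace.basis class_ring (module_vec TYPE('a) n) (set F)"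

definition orthogonal_basis :: "nat \<Rightarrow> 'a :: conjugatable_field vec list \<Rightarrow> bool" where
  "orthogonal_basis n F \<longleftrightarrow> basis_seq n F \<and> corthogonal F"

definition frame :: "nat \<Rightarrow> 'a :: field vec list \<Rightarrow> bool" where
  "frame n F \<longleftrightarrow>
     set F \<subseteq> carrier_vec n \<and>
     LinearCombinations.module.span class_ring (module_vec TYPE('a) n) (set F) = carrier_vec n"

definition parseval_frame ::
    "nat \<Rightarrow> 'a :: {conjugatable_field, real_normed_field} vec list \<Rightarrow> bool" where
  "parseval_frame n F \<longleftrightarrow>
     set F \<subseteq> carrier_vec n \<and>
     (\<forall>f \<in> carrier_vec n.
        (\<Sum>i<length F. (norm (f \<bullet>c F ! i))\<^sup>2) = (euclidean_norm f)\<^sup>2)"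

definition scalable ::
    "nat \<Rightarrow> 'a :: {conjugatable_field, real_normed_field} vec list \<Rightarrow> bool" where
  "scalable n F \<longleftrightarrow>
     frame n F \<and>
     (\<exists>c :: nat \<Rightarrow> 'a. parseval_frame n (map (\<lambda>i. c i \<cdot>\<^sub>v F ! i) [0..<length F]))"

end

theory Submission
  imports Defs
begin

text \<open>
  Suppose \<open>n\<close> vectors \<open>g\<^sub>i\<close> form a Parseval frame. Testing the Parseval identity on \<open>g\<^sub>j\<close> gives
  \<open>\<parallel>g\<^sub>j\<parallel>\<^sup>4 \<le> \<parallel>g\<^sub>j\<parallel>\<^sup>2\<close>, so \<open>\<parallel>g\<^sub>j\<parallel> \<le> 1\<close>; testing it on the unit vectors and adding up gives
  \<open>\<Sum>\<^sub>j \<parallel>g\<^sub>j\<parallel>\<^sup>2 = n\<close>. Hence all norms are \<open>1\<close>, and then the identity at \<open>g\<^sub>j\<close> leaves no room for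
  the terms with \<open>i \<noteq> j\<close>: the \<open>g\<^sub>i\<close> are orthonormal. Conversely, an orthogonal basis
  can be normalised, and \<open>n\<close> orthonormal vectors satisfy \<open>G\<^sup>* G = 1\<close>, hence \<open>G G\<^sup>* = 1\<close>, which is
  the Parseval identity.
\<close>

text \<open>Allows a single argument for \<open>real\<close> and \<open>complex\<close>. The two
  parent classes do not relate conjugation to the norm; the axiom supplies this link, so that
  \<open>v \<bullet>c v\<close> becomes the squared Euclidean norm.\<close>

class normed_conjugatable_field = conjugatable_field + real_normed_field +
  assumes mult_conjugate_scaleR: "x * conjugate x = (norm x)\<^sup>2 *\<^sub>R 1"

instance real :: normed_conjugatable_field
  by intro_classes (simp add: power2_eq_square)

instance complex :: normed_conjugatable_field
  by intro_classes (simp add: complex_norm_square scaleR_conv_of_real flip: of_real_power)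

lemma mult_conjugate_norm:
  fixes x :: "'a :: normed_conjugatable_field"
  shows "x * conjugate x = of_real ((norm x)\<^sup>2)"
  by (simp only: mult_conjugate_scaleR of_real_def)

lemma norm_conjugate [simp]:
  fixes x :: "'a :: normed_conjugatable_field"
  shows "norm (conjugate x) = norm x"
proof (cases "x = 0")
  case False
  have "norm x * norm (conjugate x) = norm x * norm x"
    using arg_cong[OF mult_conjugate_norm[of x], of norm]
    by (simp add: norm_mult power2_eq_square)
  with False show ?thesis by simp
qed simp

lemma euclidean_norm_sq: "(euclidean_norm v)\<^sup>2 = (\<Sum>j<dim_vec v. (norm (v $ j))\<^sup>2)"
  by (simp add: euclidean_norm_def L2_set_def sum_nonneg)

lemma cscalar_prod_self:
  fixes v :: "'a :: normed_conjugatable_field vec"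
  shows "v \<bullet>c v = of_real ((euclidean_norm v)\<^sup>2)"
  by (simp add: scalar_prod_def euclidean_norm_sq mult_conjugate_norm atLeast0LessThan)

lemma cscalar_prod_smult_smult:
  fixes v w :: "'a :: conjugatable_field vec"
  assumes "dim_vec v = dim_vec w"
  shows "(a \<cdot>\<^sub>v v) \<bullet>c (b \<cdot>\<^sub>v w) = a * conjugate b * (v \<bullet>c w)"
  using assms by (simp add: conjugate_smult_vec)

lemma parseval_frame_orthonormal:
  fixes G :: "'a :: normed_conjugatable_field vec list"
  assumes pf: "parseval_frame n G" and len: "length G = n" and ij: "i < n" "j < n"
  shows "G ! j \<bullet>c G ! i = (if i = j then 1 else 0)"
proof -
  define q where "q k = (euclidean_norm (G ! k))\<^sup>2" for k
  have carrier: "G ! k \<in> carrier_vec n" if "k < n" for k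
    using pf that len unfolding parseval_frame_def by (meson nth_mem subsetD)
  have parseval: "(\<Sum>k<n. (norm (f \<bullet>c G ! k))\<^sup>2) = (euclidean_norm f)\<^sup>2"
    if "f \<in> carrier_vec n" for f
    using pf that by (simp add: parseval_frame_def len)
  have diag: "(norm (G ! k \<bullet>c G ! k))\<^sup>2 = (q k)\<^sup>2" for k
    by (simp only: cscalar_prod_self q_def norm_of_real power2_abs)
  \<comment> \<open>The Parseval identity at \<open>G ! k\<close>, with the term of
    \<open>G ! k\<close> itself separated from the rest.\<close>
  have split: "q k = (q k)\<^sup>2 + (\<Sum>l\<in>{..<n} - {k}. (norm (G ! k \<bullet>c G ! l))\<^sup>2)" if "k < n" for k
    using parseval[OF carrier[OF that]] that
    by (simp add: sum.remove[of "{..<n}" k] diag) (simp add: q_def)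
  have q_le: "q k \<le> 1" if "k < n" for k
  proof -
    have "q k * q k \<le> q k"
      using split[OF that] sum_nonneg[of "{..<n} - {k}" "\<lambda>l. (norm (G ! k \<bullet>c G ! l))\<^sup>2"]
      by (simp add: power2_eq_square)
    moreover have "q k \<ge> 0" by (simp add: q_def)
    ultimately show ?thesis
      using mult_le_cancel_left_pos[of "q k" "q k" 1] by (cases "q k = 0") auto
  qed
  \<comment> \<open>Pairing with a unit vector reads off one coordinate of each
    \<open>G ! k\<close>, up to conjugation.\<close>
  have column: "(\<Sum>k<n. (norm (G ! k $ m))\<^sup>2) = 1" if m: "m < n" for m
  proof -
    have "(norm ((unit_vec n m :: 'a vec) $ l))\<^sup>2 = (if l = m then 1 else 0)" if "l < n" for l
      using that m by simp
    then have "(euclidean_norm (unit_vec n m :: 'a vec))\<^sup>2 = 1"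
      using m by (simp add: euclidean_norm_sq)
    moreover have "norm (unit_vec n m \<bullet>c G ! k) = norm (G ! k $ m)" if "k < n" for k
      using carrier[OF that] m by simp
    ultimately show ?thesis
      using parseval[of "unit_vec n m"] by simp
  qed
  \<comment> \<open>Double counting: the squared moduli of all entries are added vector by vector,
    then coordinate by coordinate.\<close>
  have "(\<Sum>k<n. q k) = (\<Sum>k<n. \<Sum>m<n. (norm (G ! k $ m))\<^sup>2)"
    by (rule sum.cong) (simp_all add: q_def euclidean_norm_sq carrier_vecD[OF carrier])
  also have "\<dots> = (\<Sum>m<n. \<Sum>k<n. (norm (G ! k $ m))\<^sup>2)"
    by (rule sum.swap)
  also have "\<dots> = real n" by (simp add: column)
  \<comment> \<open>All summands are nonnegative by \<open>q_le\<close>, so each of them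
    vanishes.\<close>
  finally have "(\<Sum>k<n. 1 - q k) = 0" by (simp add: sum_subtractf)
  then have q1: "q k = 1" if "k < n" for k
    using that q_le by (subst (asm) sum_nonneg_eq_0_iff) auto
  show ?thesis
  proof (cases "i = j")
    case True
    then show ?thesis
      using q1[OF ij(2)] by (simp add: cscalar_prod_self q_def)
  next
    case False
    have "(\<Sum>l\<in>{..<n} - {j}. (norm (G ! j \<bullet>c G ! l))\<^sup>2) = 0"
      using split[OF ij(2)] q1[OF ij(2)] by simp
    then show ?thesis
      using ij False by (subst (asm) sum_nonneg_eq_0_iff) auto
  qed
qed

lemma orthonormal_parseval_frame:
  fixes G :: "'a :: normed_conjugatable_field vec list"
  assumes carrier: "set G \<subseteq> carrier_vec n" and len: "length G = n"
    and orth: "\<And>i j. i < n \<Longrightarrow> j < n \<Longrightarrow> G ! j \<bullet>c G ! i = (if i = j then 1 else 0)"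
  shows "parseval_frame n G"
proof -
  \<comment> \<open>\<open>B\<close> has the vectors as columns and \<open>A\<close> is its
    conjugate transpose, so \<open>A * B\<close> collects the inner products of the vectors. As
    \<open>length G = n\<close>, both are square and a left inverse is also a right inverse.\<close>
  define A where "A = mat n n (\<lambda>(i, j). conjugate (G ! i $ j))"
  define B where "B = mat n n (\<lambda>(i, j). G ! j $ i)"
  have G: "G ! k \<in> carrier_vec n" if "k < n" for k
    using carrier that len by (meson nth_mem subsetD)
  have AB: "A \<in> carrier_mat n n" "B \<in> carrier_mat n n"
    by (auto simp: A_def B_def)
  have "A * B = 1\<^sub>m n"
  proof (rule eq_matI)
    fix i j assume "i < dim_row (1\<^sub>m n :: 'a mat)" "j < dim_col (1\<^sub>m n :: 'a mat)"
    then have ij: "i < n" "j < n" by auto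
    have "(A * B) $$ (i, j) = G ! j \<bullet>c G ! i"
      using ij G[OF ij(1)] G[OF ij(2)]
      by (simp add: A_def B_def scalar_prod_def mult.commute)
    then show "(A * B) $$ (i, j) = 1\<^sub>m n $$ (i, j)"
      using ij orth by simp
  qed (auto simp: A_def B_def)
  then have BA: "B * A = 1\<^sub>m n"
    using mat_mult_left_right_inverse AB by blast
  have entry: "(\<Sum>i<n. G ! i $ k * conjugate (G ! i $ j)) = (if j = k then 1 else 0)"
    if "j < n" "k < n" for j k
    using arg_cong[OF BA, of "\<lambda>M. M $$ (k, j)"] that
    by (auto simp: A_def B_def scalar_prod_def atLeast0LessThan)
  have "(\<Sum>i<length G. (norm (f \<bullet>c G ! i))\<^sup>2) = (euclidean_norm f)\<^sup>2"
    if f: "f \<in> carrier_vec n" for f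
  proof -
    have coeff: "f \<bullet>c G ! i = (\<Sum>j<n. f $ j * conjugate (G ! i $ j))" if "i < n" for i
      using G[OF that] by (simp add: scalar_prod_def atLeast0LessThan)
    \<comment> \<open>Expand each squared coefficient into a double sum and move the sum over
      \<open>i\<close> innermost, where \<open>entry\<close> collapses it to a Kronecker delta. The
      computation runs in the scalar field; injectivity of \<open>of_real\<close> brings it back to
      the reals.\<close>
    have "of_real (\<Sum>i<n. (norm (f \<bullet>c G ! i))\<^sup>2)
        = (\<Sum>i<n. (f \<bullet>c G ! i) * conjugate (f \<bullet>c G ! i))"
      by (simp add: mult_conjugate_norm)
    also have "\<dots> = (\<Sum>i<n. \<Sum>j<n. \<Sum>k<n.
        f $ j * conjugate (f $ k) * (G ! i $ k * conjugate (G ! i $ j)))"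
      by (simp add: coeff sum_conjugate conjugate_dist_mul sum_product mult_ac)
    also have "\<dots> = (\<Sum>j<n. \<Sum>i<n. \<Sum>k<n.
        f $ j * conjugate (f $ k) * (G ! i $ k * conjugate (G ! i $ j)))"
      by (rule sum.swap)
    also have "\<dots> = (\<Sum>j<n. \<Sum>k<n. \<Sum>i<n.
        f $ j * conjugate (f $ k) * (G ! i $ k * conjugate (G ! i $ j)))"
      by (intro sum.cong refl sum.swap)
    also have "\<dots> = (\<Sum>j<n. \<Sum>k<n. f $ j * conjugate (f $ k) * (if j = k then 1 else 0))"
      by (intro sum.cong refl) (simp add: sum_distrib_left[symmetric] entry)
    also have "\<dots> = (\<Sum>j<n. f $ j * conjugate (f $ j))"
      by (simp add: if_distrib cong: if_cong)
    also have "\<dots> = of_real ((euclidean_norm f)\<^sup>2)"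
      using f by (simp add: euclidean_norm_sq mult_conjugate_norm)
    finally show ?thesis
      unfolding len of_real_eq_iff .
  qed
  then show ?thesis
    using carrier by (simp add: parseval_frame_def)
qed

lemma basis_seq_frame:
  fixes F :: "'a :: field vec list"
  assumes "basis_seq n F"
  shows "frame n F"
proof -
  interpret vec_space "TYPE('a)" n .
  show ?thesis
    using assms by (auto simp: basis_seq_def frame_def basis_def)
qed

lemma scalable_iff_orthogonal_basis:
  fixes F :: "'a :: normed_conjugatable_field vec list"
  assumes len: "length F = n" and basis: "basis_seq n F"
  shows "scalable n F \<longleftrightarrow> orthogonal_basis n F"
proof -
  have carrier: "set F \<subseteq> carrier_vec n"
    using basis_seq_frame[OF basis] by (simp add: frame_def)
  then have dim: "dim_vec (F ! k) = n" if "k < n" for k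
    using that len by (meson carrier_vecD nth_mem subsetD)
  define scale where "scale c = map (\<lambda>i. c i \<cdot>\<^sub>v F ! i) [0..<n]" for c :: "nat \<Rightarrow> 'a"
  have scaled: "scale c ! j \<bullet>c scale c ! i = c j * conjugate (c i) * (F ! j \<bullet>c F ! i)"
    if "i < n" "j < n" for c i j
    using cscalar_prod_smult_smult[of "F ! j" "F ! i"] that by (simp add: scale_def dim)
  show ?thesis
  proof
    assume "scalable n F"
    then obtain c where "parseval_frame n (scale c)"
      unfolding scalable_def len scale_def by blast
    then have on: "c j * conjugate (c i) * (F ! j \<bullet>c F ! i) = (if i = j then 1 else 0)"
      if "i < n" "j < n" for i j
      using parseval_frame_orthonormal[of n "scale c" i j] scaled[of i j] that
      by (simp add: scale_def)
    \<comment> \<open>On the diagonal the product in \<open>on\<close> equals 1, so no factor is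
      zero. Dividing by the scalars then carries orthogonality back to \<open>F\<close>.\<close>
    have c0: "c i \<noteq> 0" if "i < n" for i
      using on[OF that that] by auto
    have "corthogonal F"
    proof
      fix i j assume ij: "i < length F" "j < length F"
      then show "F ! i \<bullet>c F ! j = 0 \<longleftrightarrow> i \<noteq> j"
        using on[of j i] c0 len by (auto split: if_splits)
    qed
    then show "orthogonal_basis n F"
      using basis by (simp add: orthogonal_basis_def)
  next
    assume "orthogonal_basis n F"
    then have orth: "F ! i \<bullet>c F ! j = 0 \<longleftrightarrow> i \<noteq> j" if "i < n" "j < n" for i j
      using that len by (auto simp: orthogonal_basis_def dest: corthogonalD)
    define c :: "nat \<Rightarrow> 'a" where "c i = of_real (1 / euclidean_norm (F ! i))" for i
    have "parseval_frame n (scale c)"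
    proof (rule orthonormal_parseval_frame)
      show "set (scale c) \<subseteq> carrier_vec n"
        using dim by (auto simp: scale_def intro!: carrier_vecI)
      fix i j assume ij: "i < n" "j < n"
      show "scale c ! j \<bullet>c scale c ! i = (if i = j then 1 else 0)"
      proof (cases "i = j")
        case True
        \<comment> \<open>\<open>corthogonal\<close> also excludes zero vectors, which makes the
          normalising factor \<open>c i\<close> meaningful.\<close>
        have "euclidean_norm (F ! i) \<noteq> 0"
          using orth[OF ij(1) ij(1)] by (auto simp: cscalar_prod_self)
        moreover have "norm (c i) = 1 / \<bar>euclidean_norm (F ! i)\<bar>"
          by (simp add: c_def norm_divide)
        ultimately show ?thesis
          using True ij unfolding scaled[OF ij]
          by (simp add: mult_conjugate_norm cscalar_prod_self power_divide)
      qed (use ij orth in \<open>simp add: scaled\<close>)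
    qed (simp add: scale_def)
    then show "scalable n F"
      using basis_seq_frame[OF basis] unfolding scalable_def len scale_def by blast
  qed
qed

theorem proposition4p8:
  fixes n :: nat
  shows "(\<forall>F :: real vec list. length F = n \<and> basis_seq n F \<longrightarrow>
            (scalable n F \<longleftrightarrow> orthogonal_basis n F)) \<and>
         (\<forall>F :: complex vec list. length F = n \<and> basis_seq n F \<longrightarrow>
            (scalable n F \<longleftrightarrow> orthogonal_basis n F))"
  by (simp add: scalable_iff_orthogonal_basis)

end
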